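(* There exists a frequently hypercyclic bounded linear operator $T$ on the Banach space $c_0(\mathbb Z)$ which does not admit any ergodic Borel probability measure with full support.
   Context: $T$ is frequently hypercyclic if there is $x$ such that for every nonempty open $V$, $\liminf_{N\to\infty}\frac1N\#\{n\in[1,N]:T^nx\in V\}>0$. A $T$-invariant Borel probability measure $m$ is ergodic if every Borel set $A$ with $T^{-1}(A)=A$ satisfies $m(A)\in\{0,1\}$; it has full support if $m(U)>0$ for every nonempty open $U$. *)

theory Defs
  imports "HOL-Probability.Probability"
begin

text \<open>c_0(Z): real sequences indexed by the integers tending to 0 as |n| tends to infinity
  (i.e. along the cofinite filter on int), with the sup norm. Realised as a subspace of the
  bounded continuous functions int => real (int carries the discrete topology).\<close>

definition c0_set :: "(int \<Rightarrow>\<^sub>C real) set" where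
  "c0_set = {f. ((\<lambda>n. apply_bcontfun f n) \<longlongrightarrow> 0) cofinite}"

typedef c0 = c0_set
  morphisms c0_rep Abs_c0
  by (rule exI[of _ 0]) (simp add: c0_set_def)

setup_lifting type_definition_c0

instantiation c0 :: real_normed_vector
begin

lift_definition zero_c0 :: c0 is 0 by (simp add: c0_set_def)
lift_definition plus_c0 :: "c0 \<Rightarrow> c0 \<Rightarrow> c0" is "(+)"
  by (auto simp: c0_set_def intro: tendsto_add_zero)
lift_definition minus_c0 :: "c0 \<Rightarrow> c0 \<Rightarrow> c0" is "(-)"
  by (auto simp: c0_set_def dest: tendsto_diff[where b=0, simplified])
lift_definition uminus_c0 :: "c0 \<Rightarrow> c0" is uminus
  using tendsto_minus[where a="0::real"] by (auto simp: c0_set_def)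
lift_definition scaleR_c0 :: "real \<Rightarrow> c0 \<Rightarrow> c0" is scaleR
  using tendsto_mult_right_zero by (auto simp: c0_set_def)
lift_definition norm_c0 :: "c0 \<Rightarrow> real" is norm .
lift_definition dist_c0 :: "c0 \<Rightarrow> c0 \<Rightarrow> real" is dist .
lift_definition sgn_c0 :: "c0 \<Rightarrow> c0" is "\<lambda>f. f /\<^sub>R norm f"
  using tendsto_mult_right_zero by (auto simp: c0_set_def)
definition uniformity_c0 :: "(c0 \<times> c0) filter" where
  "uniformity_c0 = (INF e\<in>{0<..}. principal {(x, y). dist x y < e})"
definition open_c0 :: "c0 set \<Rightarrow> bool" where
  "open_c0 U = (\<forall>x\<in>U. \<forall>\<^sub>F (x', y) in uniformity. x' = x \<longrightarrow> y \<in> U)"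

instance
proof
  fix x y z :: c0 and a b :: real and U :: "c0 set"
  show "x + y + z = x + (y + z)" by transfer (simp add: add.assoc)
  show "x + y = y + x" by transfer (simp add: add.commute)
  show "0 + x = x" by transfer simp
  show "- x + x = 0" by transfer simp
  show "x - y = x + - y" by transfer simp
  show "a *\<^sub>R (x + y) = a *\<^sub>R x + a *\<^sub>R y" by transfer (simp add: scaleR_add_right)
  show "(a + b) *\<^sub>R x = a *\<^sub>R x + b *\<^sub>R x" by transfer (simp add: scaleR_add_left)
  show "a *\<^sub>R b *\<^sub>R x = (a * b) *\<^sub>R x" by transfer simp
  show "1 *\<^sub>R x = x" by transfer simp
  show "dist x y = norm (x - y)" by transfer (simp add: dist_norm)
  show "sgn x = inverse (norm x) *\<^sub>R x" by transfer (simp add: divide_inverse_commute)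
  show "(norm x = 0) = (x = 0)" by transfer simp
  show "norm (x + y) \<le> norm x + norm y" by transfer (rule norm_triangle_ineq)
  show "norm (a *\<^sub>R x) = \<bar>a\<bar> * norm x" by transfer simp
  show "(uniformity :: (c0 \<times> c0) filter) = (INF e\<in>{0<..}. principal {(x, y). dist x y < e})"
    by (simp add: uniformity_c0_def)
  show "open U = (\<forall>x\<in>U. \<forall>\<^sub>F (x', y) in uniformity. x' = x \<longrightarrow> y \<in> U)"
    by (simp add: open_c0_def)
qed

end

definition freq_hypercyclic :: "('a::topological_space \<Rightarrow> 'a) \<Rightarrow> bool" where
  "freq_hypercyclic T \<longleftrightarrow>
     (\<exists>x. \<forall>V. open V \<and> V \<noteq> {} \<longrightarrow>
        liminf (\<lambda>N::nat. ereal (real (card {n \<in> {1..N}. (T ^^ n) x \<in> V}) / real N)) > 0)"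

definition borel_prob_measure :: "'a::topological_space measure \<Rightarrow> bool" where
  "borel_prob_measure m \<longleftrightarrow> sets m = sets borel \<and> prob_space m"

definition invariant_measure :: "('a::topological_space \<Rightarrow> 'a) \<Rightarrow> 'a measure \<Rightarrow> bool" where
  "invariant_measure T m \<longleftrightarrow> (\<forall>A \<in> sets borel. emeasure m (T -` A) = emeasure m A)"

definition ergodic_measure :: "('a::topological_space \<Rightarrow> 'a) \<Rightarrow> 'a measure \<Rightarrow> bool" where
  "ergodic_measure T m \<longleftrightarrow>
     (\<forall>A \<in> sets borel. T -` A = A \<longrightarrow> emeasure m A = 0 \<or> emeasure m A = 1)"

definition full_support :: "'a::topological_space measure \<Rightarrow> bool" where
  "full_support m \<longleftrightarrow> (\<forall>U. open U \<and> U \<noteq> {} \<longrightarrow> emeasure m U > 0)"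

end

theory Submission
  imports Defs
begin

text \<open>
  \<open>T\<close> is the weighted backward shift \<open>(Tx)\<^sub>j = (W (j+1) / W j) x\<^sub>j\<^sub>+\<^sub>1\<close> with \<open>W = 2 ^ elev\<close>.

  Suppose \<open>W d = 1\<close> for all \<open>d\<close> in a set \<open>D\<close> of natural numbers of upper density at least \<open>1/5\<close>.
  If \<open>\<parallel>x\<parallel> \<le> R\<close> and \<open>d \<in> D\<close>, then the coordinate of \<open>T ^ d x\<close> at \<open>0\<close> is \<open>x\<^sub>d\<close>, hence at most \<open>R\<close> in
  absolute value: orbits starting in the ball of radius \<open>R\<close> avoid \<open>A = {x. |x\<^sub>0| > R}\<close> at all times
  in \<open>D\<close>. For an ergodic measure the visits to \<open>A\<close> of almost every orbit have frequency \<open>m A\<close>,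
  whereas those at times in \<open>D\<close> amount on average to at least \<open>m A / 5\<close> and come only from starting
  points outside the ball. If \<open>m A > 0\<close>, the ball thus has measure at most \<open>4/5\<close> for every \<open>R\<close>,
  which is absurd.

  For frequent hypercyclicity, a pattern with index \<open>p\<close> is planted around each point of a set
  \<open>E\<^sub>p\<close> of positive lower density, and \<open>W\<close> has to be large on \<open>E\<^sub>q - E\<^sub>p\<close>. Here \<open>E\<^sub>p\<close> consists
  of the multiples of a sparse period in the blocks \<open>[10 ^ u, 2 * 10 ^ u)\<close> for which the 2-adic
  valuation of \<open>u\<close> is \<open>p\<close>. Differences between distinct blocks \<open>u > v\<close> lie close to the block \<open>u\<close>, and
  differences inside one block are multiples of the period, so \<open>W\<close> can stay equal to \<open>1\<close> on most of
  \<open>(3 * 10 ^ u, 5 * 10 ^ u)\<close>. Negative differences are harmless since \<open>W (-n) = 2 ^ n\<close>.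
\<close>

section \<open>Visits under ergodic transformations\<close>

text \<open>Maximum of the partial sums of \<open>g\<close> along the orbit over lengths at most
  \<open>n\<close>, the empty sum included. Peeling off the first term makes the values at
  \<open>x\<close> and at \<open>T x\<close> directly comparable.\<close>

primrec max_partial_sum :: "('a \<Rightarrow> 'a) \<Rightarrow> ('a \<Rightarrow> real) \<Rightarrow> nat \<Rightarrow> 'a \<Rightarrow> real" where
  "max_partial_sum T g 0 x = 0"
| "max_partial_sum T g (Suc n) x = max 0 (g x + max_partial_sum T g n (T x))"

lemma max_partial_sum_nonneg: "0 \<le> max_partial_sum T g n x"
  by (cases n) auto

lemma max_partial_sum_mono: "max_partial_sum T g n x \<le> max_partial_sum T g (Suc n) x"
proof (induction n arbitrary: x)
  case (Suc n)
  have "g x + max_partial_sum T g n (T x) \<le> g x + max_partial_sum T g (Suc n) (T x)"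
    using Suc.IH by simp
  then show ?case
    unfolding max_partial_sum.simps(2)[of T g "Suc n"] max_partial_sum.simps(2)[of T g n x]
    by (rule max.mono[OF order_refl])
qed simp

lemma sum_le_max_partial_sum: "(\<Sum>k<n. g ((T ^^ k) x)) \<le> max_partial_sum T g n x"
proof (induction n arbitrary: x)
  case (Suc n)
  have "(\<Sum>k<Suc n. g ((T ^^ k) x)) = g x + (\<Sum>k<n. g ((T ^^ k) (T x)))"
    by (simp add: sum.lessThan_Suc_shift funpow_Suc_right del: sum.lessThan_Suc funpow.simps)
  then show ?case using Suc[of "T x"] by simp
qed simp

locale measure_preserving = prob_space +
  fixes T :: "'a \<Rightarrow> 'a"
  assumes T_meas [measurable]: "T \<in> measurable M M"
    and T_distr: "distr M M T = M"
begin

lemma funpow_meas [measurable]: "T ^^ n \<in> measurable M M"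
  by (induction n) (auto intro: measurable_comp)

lemma integrable_comp:
  fixes f :: "'a \<Rightarrow> real"
  assumes "integrable M f"
  shows "integrable M (\<lambda>x. f (T x))"
proof -
  have "integrable (distr M M T) f" using assms by (simp add: T_distr)
  then show ?thesis by (rule integrable_distr[OF T_meas])
qed

lemma integral_comp:
  fixes f :: "'a \<Rightarrow> real"
  assumes "f \<in> borel_measurable M"
  shows "(\<integral>x. f (T x) \<partial>M) = (\<integral>x. f x \<partial>M)"
  using integral_distr[OF T_meas assms] by (simp add: T_distr)

lemma integral_comp_funpow:
  fixes f :: "'a \<Rightarrow> real"
  assumes [measurable]: "f \<in> borel_measurable M"
  shows "(\<integral>x. f ((T ^^ n) x) \<partial>M) = (\<integral>x. f x \<partial>M)"
proof (induction n)
  case (Suc n)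
  have "(\<integral>x. f ((T ^^ Suc n) x) \<partial>M) = (\<integral>x. f ((T ^^ n) (T x)) \<partial>M)"
    by (simp add: funpow_swap1)
  also have "\<dots> = (\<integral>x. f ((T ^^ n) x) \<partial>M)"
    by (rule integral_comp[where f = "\<lambda>x. f ((T ^^ n) x)"]) measurable
  finally show ?case using Suc by simp
qed simp

lemma integrable_max_partial_sum:
  assumes "integrable M g"
  shows "integrable M (max_partial_sum T g n)"
proof (induction n)
  case (Suc n)
  have "integrable M (\<lambda>x. max 0 (g x + max_partial_sum T g n (T x)))"
    using assms integrable_comp[OF Suc] by simp
  then show ?case by simp
qed simp

text \<open>Garsia's argument: where \<open>F = max_partial_sum T g n\<close> is positive, \<open>F - F \<circ> T \<le> g\<close>.\<close>

lemma maximal_ergodic_inequality: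
  assumes g: "integrable M g"
  shows "0 \<le> (\<integral>x. g x * indicator {x. max_partial_sum T g n x > 0} x \<partial>M)"
proof -
  let ?F = "max_partial_sum T g n"
  have F: "integrable M ?F" by (rule integrable_max_partial_sum[OF g])
  have [measurable]: "?F \<in> borel_measurable M" using F by simp
  have "?F x - ?F (T x) \<le> g x * indicator {x. ?F x > 0} x" for x
  proof (cases "?F x > 0")
    case True
    then obtain k where k: "n = Suc k" by (cases n) auto
    have "?F x = g x + max_partial_sum T g k (T x)" using True k by simp
    also have "\<dots> \<le> g x + ?F (T x)" using max_partial_sum_mono k by simp
    finally show ?thesis using True by simp
  next
    case False
    then show ?thesis using max_partial_sum_nonneg[of T g n "T x"] by simp
  qed
  moreover have "integrable M (\<lambda>x. g x * indicator {x. ?F x > 0} x)"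
  proof -
    have "integrable M (\<lambda>x. g x * indicator {x. ?F x > 0} x)
        \<longleftrightarrow> integrable M (\<lambda>x. indicator {x\<in>space M. ?F x > 0} x *\<^sub>R g x)"
      by (rule Bochner_Integration.integrable_cong) (simp_all add: indicator_def)
    moreover have "integrable M (\<lambda>x. indicator {x\<in>space M. ?F x > 0} x *\<^sub>R g x)"
      using g by (intro integrable_mult_indicator) measurable
    ultimately show ?thesis by simp
  qed
  ultimately have "(\<integral>x. ?F x - ?F (T x) \<partial>M) \<le> (\<integral>x. g x * indicator {x. ?F x > 0} x \<partial>M)"
    using F integrable_comp[OF F] by (intro integral_mono) auto
  moreover have "(\<integral>x. ?F x - ?F (T x) \<partial>M) = 0"
    using F integrable_comp[OF F] integral_comp[of ?F] by simp
  ultimately show ?thesis by simp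
qed

text \<open>The sets where \<open>max_partial_sum T g n\<close> is positive increase with
  \<open>n\<close> and exhaust the space up to a null set, so dominated convergence carries the
  maximal inequality over to the whole integral.\<close>

lemma integral_nonneg_if_AE_partial_sum_pos:
  fixes g :: "'a \<Rightarrow> real"
  assumes g: "integrable M g"
    and pos: "AE x in M. \<exists>n. (\<Sum>k<n. g ((T ^^ k) x)) > 0"
  shows "0 \<le> (\<integral>x. g x \<partial>M)"
proof -
  let ?F = "max_partial_sum T g"
  have [measurable]: "?F n \<in> borel_measurable M" "g \<in> borel_measurable M" for n
    using integrable_max_partial_sum[OF g] g by auto
  have "(\<lambda>n. \<integral>x. g x * indicator {x. ?F n x > 0} x \<partial>M) \<longlonglongrightarrow> (\<integral>x. g x \<partial>M)"
  proof (rule integral_dominated_convergence[where w = "\<lambda>x. \<bar>g x\<bar>"])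
    show "AE x in M. (\<lambda>n. g x * indicator {x. ?F n x > 0} x) \<longlonglongrightarrow> g x"
      using pos
    proof eventually_elim
      case (elim x)
      then obtain n where "(\<Sum>k<n. g ((T ^^ k) x)) > 0" ..
      then have n: "?F n x > 0" by (rule less_le_trans[OF _ sum_le_max_partial_sum])
      have "?F n x \<le> ?F m x" if "m \<ge> n" for m
        by (rule lift_Suc_mono_le[OF _ that]) (rule max_partial_sum_mono)
      then have "?F m x > 0" if "m \<ge> n" for m
        using that n by (auto intro: less_le_trans)
      then have "\<forall>\<^sub>F m in sequentially. g x = g x * indicator {x. ?F m x > 0} x"
        unfolding eventually_sequentially by (intro exI[of _ n]) simp
      then show ?case by (rule Lim_transform_eventually[OF tendsto_const])
    qed
    show "(\<lambda>x. g x * indicator {x. ?F n x > 0} x) \<in> borel_measurable M" for n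
      by measurable
    show "integrable M (\<lambda>x. \<bar>g x\<bar>)" using g by (rule integrable_abs)
    show "AE x in M. norm (g x * indicator {x. ?F n x > 0} x) \<le> \<bar>g x\<bar>" for n
      by (rule AE_I2) (simp add: indicator_def)
  qed measurable
  then show ?thesis
    by (rule LIMSEQ_le_const) (intro exI[of _ 0] allI impI maximal_ergodic_inequality[OF g])
qed

section \<open>Visit frequencies\<close>

definition visits :: "'a set \<Rightarrow> nat \<Rightarrow> 'a \<Rightarrow> real" where
  "visits A n x = (\<Sum>k<n. indicator A ((T ^^ k) x))"

lemma visits_meas [measurable]: "A \<in> sets M \<Longrightarrow> visits A n \<in> borel_measurable M"
  unfolding visits_def
  by (intro borel_measurable_sum measurable_compose[OF funpow_meas]) simp

lemma visits_bounds: "0 \<le> visits A n x" "visits A n x \<le> real n"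
proof -
  show "0 \<le> visits A n x" unfolding visits_def by (intro sum_nonneg) auto
  have "visits A n x \<le> (\<Sum>k<n. 1)"
    unfolding visits_def by (intro sum_mono) (auto simp: indicator_def)
  then show "visits A n x \<le> real n" by simp
qed

text \<open>Passing from \<open>x\<close> to \<open>T x\<close> drops the first term of the count
  and adds one at the end, so the averages differ by at most \<open>1 / n\<close>.\<close>

lemma limsup_visits_invariant:
  "limsup (\<lambda>n. ereal (visits A n (T x) / real n)) = limsup (\<lambda>n. ereal (visits A n x / real n))"
proof -
  let ?e = "\<lambda>n. visits A n (T x) / real n - visits A n x / real n"
  have eq: "visits A n (T x) - visits A n x = indicator A ((T ^^ n) x) - indicator A x" for n
    unfolding visits_def by (induction n) (simp_all add: funpow_swap1[of T])
  have "?e \<longlonglongrightarrow> 0"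
  proof (rule Lim_null_comparison)
    show "\<forall>\<^sub>F n in sequentially. norm (?e n) \<le> 1 / real n"
    proof (rule always_eventually, rule allI)
      fix n
      have "?e n = (indicator A ((T ^^ n) x) - indicator A x) / real n"
        by (simp only: diff_divide_distrib[symmetric] eq)
      also have "norm \<dots> \<le> 1 / real n"
        by (auto simp: indicator_def)
      finally show "norm (?e n) \<le> 1 / real n" .
    qed
  qed (rule lim_1_over_n)
  then have "(\<lambda>n. ereal (?e n)) \<longlonglongrightarrow> 0" by (simp add: zero_ereal_def)
  then have "limsup (\<lambda>n. ereal (?e n) + ereal (visits A n x / real n))
      = 0 + limsup (\<lambda>n. ereal (visits A n x / real n))"
    by (rule ereal_limsup_lim_add) simp
  then show ?thesis by simp
qed

text \<open>Upper half of Birkhoff's theorem for an indicator. The set where the limsup exceeds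
  \<open>t\<close> is invariant; if it had measure 1, almost every orbit would have a positive
  partial sum of \<open>indicator A - t\<close>, forcing \<open>t \<le> measure M A\<close>.\<close>

lemma AE_limsup_visits_le:
  assumes erg: "\<And>B. B \<in> sets M \<Longrightarrow> T -` B \<inter> space M = B \<Longrightarrow> emeasure M B = 0 \<or> emeasure M B = 1"
    and A [measurable]: "A \<in> sets M" and t: "measure M A < t"
  shows "AE x in M. limsup (\<lambda>n. ereal (visits A n x / real n)) \<le> ereal t"
proof -
  let ?L = "\<lambda>x. limsup (\<lambda>n. ereal (visits A n x / real n))"
  define B where "B = {x \<in> space M. ereal t < ?L x}"
  have [measurable]: "?L \<in> borel_measurable M" by measurable
  have B: "B \<in> sets M" unfolding B_def by measurable
  have "T -` B \<inter> space M = B"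
    unfolding B_def using measurable_space[OF T_meas] by (auto simp: limsup_visits_invariant)
  then consider "emeasure M B = 0" | "emeasure M B = 1" using erg[OF B] by blast
  then show ?thesis
  proof cases
    case 1
    then have "AE x in M. x \<notin> B" using B by (intro AE_not_in) (simp add: null_sets_def)
    then show ?thesis by (rule AE_mp) (auto simp: B_def not_less)
  next
    case 2
    then have "AE x in M. x \<in> B"
      using B by (intro AE_prob_1) (simp add: measure_def)
    then have "AE x in M. \<exists>n. (\<Sum>k<n. indicator A ((T ^^ k) x) - t) > 0"
    proof eventually_elim
      case (elim x)
      have "\<exists>n. visits A n x > real n * t"
      proof (rule ccontr)
        assume "\<not> ?thesis"
        then have "visits A n x / real n \<le> t" if "n > 0" for n
          using that by (simp add: not_less field_simps)
        then have "\<forall>\<^sub>F n in sequentially. ereal (visits A n x / real n) \<le> ereal t"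
          unfolding eventually_sequentially by (intro exI[of _ 1]) auto
        then have "?L x \<le> ereal t" by (rule Limsup_bounded)
        with elim show False unfolding B_def by (auto dest: leD)
      qed
      then show ?case by (auto simp: visits_def sum_subtractf)
    qed
    moreover have int_A: "integrable M (indicator A :: _ \<Rightarrow> real)"
      by (rule integrable_const_bound[where B = 1]) (auto simp: indicator_def)
    ultimately have "0 \<le> (\<integral>x. indicator A x - t \<partial>M)"
      by (intro integral_nonneg_if_AE_partial_sum_pos) auto
    also have "\<dots> = measure M A - t" using int_A by (simp add: prob_space)
    finally show ?thesis using t by simp
  qed
qed

text \<open>Double counting of the visits to \<open>A\<close> at times of \<open>D\<close> below
  \<open>N\<close>: invariance makes their mean at least \<open>c * N * measure M A\<close>, while
  starting points outside \<open>G\<close> supply little more than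
  \<open>N * measure M A * measure M (space M - G)\<close>.\<close>

proposition prob_le_if_misses_upper_density:
  assumes erg: "\<And>B. B \<in> sets M \<Longrightarrow> T -` B \<inter> space M = B \<Longrightarrow> emeasure M B = 0 \<or> emeasure M B = 1"
    and A [measurable]: "A \<in> sets M" and G [measurable]: "G \<in> sets M"
    and pos: "0 < measure M A"
    and avoid: "\<And>x d. x \<in> G \<Longrightarrow> d \<in> D \<Longrightarrow> (T ^^ d) x \<notin> A"
    and dens: "\<exists>\<^sub>F N in sequentially. c * real N \<le> real (card (D \<inter> {..<N}))"
  shows "measure M G \<le> 1 - c"
proof (rule ccontr)
  assume neg: "\<not> measure M G \<le> 1 - c"
  define \<epsilon> where "\<epsilon> = measure M (space M - G)"
  have \<epsilon>: "\<epsilon> < c" "0 \<le> \<epsilon>"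
    using neg prob_compl[OF G] by (auto simp: \<epsilon>_def)
  \<comment> \<open>Makes \<open>\<delta> * (1 + \<epsilon>)\<close> half of
    \<open>(c - \<epsilon>) * measure M A\<close>, while the counting would require more than that
    full amount.\<close>
  define \<delta> where "\<delta> = (c - \<epsilon>) * measure M A / (2 * (1 + \<epsilon>))"
  have \<delta>: "\<delta> > 0" using \<epsilon> pos by (auto simp: \<delta>_def)
  define t where "t = measure M A + \<delta>"
  have [measurable]: "space M - G \<in> sets M" by auto
  \<comment> \<open>Excess of the visit frequency over \<open>t\<close>: bounded by 1 and almost
    everywhere eventually 0, so its integral tends to 0.\<close>
  let ?h = "\<lambda>n x. max 0 (visits A n x / real n - t)"
  have "(\<lambda>n. \<integral>x. ?h n x \<partial>M) \<longlonglongrightarrow> (\<integral>x. 0 \<partial>M)"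
  proof (rule integral_dominated_convergence[where w = "\<lambda>_. 1"])
    have "AE x in M. limsup (\<lambda>n. ereal (visits A n x / real n)) \<le> ereal (measure M A + \<delta> / 2)"
      using \<delta> by (intro AE_limsup_visits_le erg) auto
    then show "AE x in M. (\<lambda>n. ?h n x) \<longlonglongrightarrow> 0"
    proof eventually_elim
      case (elim x)
      have "limsup (\<lambda>n. ereal (visits A n x / real n)) < ereal t"
        using \<delta> by (intro le_less_trans[OF elim]) (simp add: t_def)
      then have "\<forall>\<^sub>F n in sequentially. ereal (visits A n x / real n) < ereal t"
        by (rule Limsup_lessD)
      then have "\<forall>\<^sub>F n in sequentially. 0 = ?h n x"
        by eventually_elim auto
      then show ?case by (rule Lim_transform_eventually[OF tendsto_const])
    qed
    show "AE x in M. norm (?h n x) \<le> 1" for n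
    proof (rule AE_I2)
      fix x
      have "visits A n x / real n \<le> 1" using visits_bounds[of A n x]
        by (auto simp: divide_le_eq_1)
      then show "norm (?h n x) \<le> 1" using \<delta> pos by (auto simp: t_def)
    qed
  qed auto
  then have "\<forall>\<^sub>F n in sequentially. (\<integral>x. ?h n x \<partial>M) < \<delta>"
    using \<delta> by (intro order_tendstoD) auto
  \<comment> \<open>The density bound holds only for infinitely many \<open>N\<close>, the integral
    bound for all large ones; some \<open>N\<close> has both.\<close>
  with dens have "\<exists>\<^sub>F N in sequentially. c * real N \<le> real (card (D \<inter> {..<N})) \<and> (\<integral>x. ?h N x \<partial>M) < \<delta> \<and> N > 0"
    using eventually_gt_at_top[of "0::nat"]
    by (intro frequently_eventually_frequently eventually_conj)
  then obtain N where N: "c * real N \<le> real (card (D \<inter> {..<N}))" "(\<integral>x. ?h N x \<partial>M) < \<delta>" "N > 0"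
    by (auto dest: frequently_ex)
  have int_h: "integrable M (?h N)"
  proof (rule integrable_const_bound[where B = 1])
    show "AE x in M. norm (?h N x) \<le> 1"
    proof (rule AE_I2)
      fix x
      have "visits A N x / real N \<le> 1" using visits_bounds[of A N x]
        by (auto simp: divide_le_eq_1)
      then show "norm (?h N x) \<le> 1" using \<delta> pos by (auto simp: t_def)
    qed
  qed measurable
  have int_A: "integrable M (\<lambda>x. indicator A ((T ^^ d) x) :: real)" for d
    by (rule integrable_const_bound[where B = 1])
      (auto intro: measurable_compose[OF funpow_meas] simp: indicator_def)
  have int_G: "integrable M (indicator (space M - G) :: _ \<Rightarrow> real)"
    by (rule integrable_const_bound[where B = 1]) (auto simp: indicator_def)
  have "c * measure M A * N \<le> real (card (D \<inter> {..<N})) * measure M A"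
    using mult_right_mono[OF N(1), of "measure M A"] by (simp add: algebra_simps)
  also have "\<dots> = (\<Sum>d\<in>D \<inter> {..<N}. \<integral>x. indicator A ((T ^^ d) x) \<partial>M)"
    using integral_comp_funpow[of "indicator A :: 'a \<Rightarrow> real"] by simp
  also have "\<dots> = (\<integral>x. (\<Sum>d\<in>D \<inter> {..<N}. indicator A ((T ^^ d) x)) \<partial>M)"
    by (rule Bochner_Integration.integral_sum[symmetric]) (rule int_A)
  also have "\<dots> \<le> (\<integral>x. real N * (t * indicator (space M - G) x + ?h N x) \<partial>M)"
  proof (rule integral_mono)
    fix x assume x: "x \<in> space M"
    show "(\<Sum>d\<in>D \<inter> {..<N}. indicator A ((T ^^ d) x))
        \<le> real N * (t * indicator (space M - G) x + ?h N x)"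
    proof (cases "x \<in> G")
      case True
      then have "(\<Sum>d\<in>D \<inter> {..<N}. indicator A ((T ^^ d) x) :: real) = 0"
        using avoid by (intro sum.neutral) auto
      then show ?thesis using True by simp
    next
      case False
      have "(\<Sum>d\<in>D \<inter> {..<N}. indicator A ((T ^^ d) x)) \<le> visits A N x"
        unfolding visits_def by (rule sum_mono2) auto
      also have "\<dots> = real N * (visits A N x / real N)" using N(3) by simp
      also have "\<dots> \<le> real N * (t * indicator (space M - G) x + ?h N x)"
        using False x by (intro mult_left_mono) auto
      finally show ?thesis .
    qed
  qed (use int_h int_A int_G in auto)
  also have "\<dots> = real N * (t * \<epsilon> + (\<integral>x. ?h N x \<partial>M))"
    using int_h int_G by (simp add: \<epsilon>_def)
  also have "\<dots> < real N * (t * \<epsilon> + \<delta>)" using N by simp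
  finally have "real N * (c * measure M A) < real N * (t * \<epsilon> + \<delta>)" by (simp add: algebra_simps)
  then have "c * measure M A < t * \<epsilon> + \<delta>" using N(3) by simp
  then have "(c - \<epsilon>) * measure M A < \<delta> * (1 + \<epsilon>)" by (simp add: t_def algebra_simps)
  also have "\<dots> = (c - \<epsilon>) * measure M A / 2" using \<epsilon> by (simp add: \<delta>_def field_simps)
  finally show False using \<epsilon> pos by (simp add: mult_less_0_iff)
qed

end

section \<open>Weights and planting sites\<close>

text \<open>The factor \<open>5 * int p + 1\<close> is the number of integers in
  \<open>[-4 p, p]\<close>, the neighbourhood that \<open>high\<close> attaches to each positive
  multiple; the factor \<open>40 * 2 ^ p\<close> leaves these neighbourhoods density
  \<open>1 / (40 * 2 ^ p)\<close>, summing to 1/20 over all \<open>p\<close>.\<close>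

definition period :: "nat \<Rightarrow> int" where
  "period p = 40 * 2 ^ p * (5 * int p + 1)"

text \<open>The first family serves differences inside one block: offsets up to \<open>p\<close>
  either way, plus \<open>3 p\<close> more points below for a run. The second serves the blocks
  themselves and differences of distinct blocks.\<close>

definition high :: "int set" where
  "high = {d. (\<exists>p k. 1 \<le> k \<and> period p * k - 4 * int p \<le> d \<and> d \<le> period p * k + int p)
      \<or> (\<exists>u::nat. 10 ^ u \<le> 2 * d \<and> d \<le> 3 * 10 ^ u)}"

text \<open>To the right of 0 this is the distance to the nearest lower point outside \<open>high\<close>, so the weights at
  most double per step and a run of \<open>r\<close> consecutive points of \<open>high\<close> forces the weight \<open>2 ^ r\<close> at its end.\<close>

definition elev :: "int \<Rightarrow> nat" where
  "elev d = (if d \<le> 0 then nat (- d) else LEAST r. d - int r \<notin> high)"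

lemma period_ge: "40 * (5 * int p + 1) \<le> period p"
proof -
  have "(1::int) \<le> 2 ^ p" by simp
  then have "40 * 1 * (5 * int p + 1) \<le> 40 * 2 ^ p * (5 * int p + 1)"
    by (intro mult_right_mono mult_left_mono) auto
  then show ?thesis by (simp add: period_def)
qed

lemma period_pos: "0 < period p"
  by (simp add: period_def)

lemma period_mult_ge:
  assumes "1 \<le> k"
  shows "200 * int p + 40 \<le> period p * k"
proof -
  have "200 * int p + 40 \<le> period p * 1" using period_ge[of p] by simp
  also have "\<dots> \<le> period p * k"
    using assms period_pos by (intro mult_left_mono) (auto simp: less_imp_le)
  finally show ?thesis .
qed

lemma high_pos: "d \<in> high \<Longrightarrow> 0 < d"
proof -
  assume "d \<in> high"
  then consider p k where "1 \<le> k" "period p * k - 4 * int p \<le> d"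
    | u :: nat where "10 ^ u \<le> 2 * d"
    unfolding high_def by blast
  then show ?thesis
  proof cases
    case 1
    then show ?thesis using period_mult_ge[of k p] by simp
  next
    case 2
    have "(0::int) < 10 ^ u" by simp
    then show ?thesis using 2 by linarith
  qed
qed

lemma elev_neg: "d \<le> 0 \<Longrightarrow> elev d = nat (- d)"
  by (simp add: elev_def)

lemma diff_elev_notin_high: "0 < d \<Longrightarrow> d - int (elev d) \<notin> high"
proof -
  assume "0 < d"
  then have "d - int (nat d) \<notin> high" using high_pos by force
  then have "d - int (LEAST r. d - int r \<notin> high) \<notin> high" by (rule LeastI)
  then show ?thesis using \<open>0 < d\<close> by (simp add: elev_def)
qed

lemma elev_le: "d - int r \<notin> high \<Longrightarrow> 0 < d \<Longrightarrow> elev d \<le> r"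
  by (simp add: elev_def Least_le)

lemma elev_le_abs: "int (elev d) \<le> \<bar>d\<bar>"
proof (cases "d \<le> 0")
  case False
  then have "d - int (nat d) \<notin> high" using high_pos by force
  then show ?thesis using elev_le[of d "nat d"] False by auto
qed (simp add: elev_neg)

text \<open>A point outside \<open>high\<close> lying \<open>r\<close> below \<open>d\<close> lies
  \<open>r + 1\<close> below \<open>d + 1\<close>. This bounds the shift; the junction
  \<open>d = 0\<close> works because \<open>high\<close> contains only positive points.\<close>

lemma elev_step: "elev (d + 1) \<le> elev d + 1"
proof (cases "d < 0")
  case False
  have "d - int (elev d) \<notin> high"
  proof (cases "d = 0")
    case True
    then show ?thesis using high_pos[of 0] by (auto simp: elev_neg)
  next
    case False
    then show ?thesis using diff_elev_notin_high \<open>\<not> d < 0\<close> by simp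
  qed
  then show ?thesis using False by (intro elev_le) auto
qed (simp add: elev_neg)

lemma elev_eq_0: "0 < d \<Longrightarrow> d \<notin> high \<Longrightarrow> elev d = 0"
  using elev_le[of d 0] by simp

lemma elev_ge:
  assumes "0 < d" and "\<And>s. 0 \<le> s \<Longrightarrow> s < r \<Longrightarrow> d - s \<in> high"
  shows "r \<le> int (elev d)"
  using diff_elev_notin_high[OF assms(1)] assms(2)[of "int (elev d)"] by fastforce

lemma elev_ge_multiple:
  assumes "1 \<le> k" "\<bar>i\<bar> \<le> int p"
  shows "3 * int p + 1 \<le> int (elev (period p * k + i))"
proof (rule elev_ge)
  show "0 < period p * k + i" using period_mult_ge[of k p] assms by simp
  fix s assume "0 \<le> s" "s < 3 * int p + 1"
  then show "period p * k + i - s \<in> high"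
    unfolding high_def using assms by (intro CollectI disjI1 exI[of _ p] exI[of _ k]) auto
qed

text \<open>The lowest point of the run is \<open>d - r + 1\<close>, whence the \<open>+ 2\<close>
  after doubling.\<close>

lemma elev_ge_decade:
  assumes "10 ^ u + 2 * r \<le> 2 * d + 2" "d \<le> 3 * 10 ^ u" "0 < d"
  shows "r \<le> int (elev d)"
proof (rule elev_ge)
  fix s assume "0 \<le> s" "s < r"
  then show "d - s \<in> high"
    unfolding high_def using assms by (intro CollectI disjI2 exI[of _ u]) auto
qed fact

section \<open>Planting sites\<close>

text \<open>Enumerates the exponents of 2-adic valuation \<open>p\<close>: different
  \<open>p\<close> never share a block, and exponents for one \<open>p\<close> recur with the fixed
  gap \<open>2 * 2 ^ p\<close>, which yields positive lower density.\<close>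

definition level :: "nat \<Rightarrow> nat \<Rightarrow> nat" where
  "level p j = 2 ^ p * (2 * j + 1)"

definition center :: "nat \<Rightarrow> int \<Rightarrow> bool" where
  "center p n \<longleftrightarrow> (\<exists>j. 10 ^ level p j \<le> n \<and> n < 2 * 10 ^ level p j \<and> period p dvd n)"

lemma level_inj: "level p j = level q l \<Longrightarrow> p = q"
proof -
  have m: "multiplicity 2 (level p j) = p" for p j
  proof (rule multiplicity_eqI)
    have "\<not> 2 ^ p * 2 dvd 2 ^ p * (2 * j + 1)"
      by (simp only: nat_mult_dvd_cancel_disj) simp
    then show "\<not> 2 ^ Suc p dvd level p j" unfolding level_def power_Suc2 .
  qed (simp add: level_def)
  assume "level p j = level q l"
  then show "p = q" using m[of p j] m[of q l] by metis
qed

lemma less_level: "p < level p j"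
proof -
  have "p < 2 ^ p" by simp
  also have "\<dots> \<le> level p j" by (simp add: level_def)
  finally show ?thesis .
qed

lemma ten_power_ge: "1 \<le> u \<Longrightarrow> 10 * int u \<le> 10 ^ u"
  by (induction u rule: dec_induct) auto

lemma ten_power_ge': "2 \<le> u \<Longrightarrow> 50 * int u \<le> 10 ^ u"
  by (induction u rule: dec_induct) auto

lemma ten_power_le: "u < v \<Longrightarrow> 10 * 10 ^ u \<le> (10::int) ^ v"
  using power_increasing[of "Suc u" v "10::int"] by simp

lemma level_unique:
  assumes "10 ^ u \<le> n" "n < 2 * (10::int) ^ u" "10 ^ v \<le> n" "n < 2 * 10 ^ v"
  shows "u = v"
proof (cases u v rule: linorder_cases)
  case less
  then show ?thesis using ten_power_le[of u v] assms by linarith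
next
  case greater
  then show ?thesis using ten_power_le[of v u] assms by linarith
qed

lemma center_unique: "center p n \<Longrightarrow> center q n \<Longrightarrow> p = q"
  unfolding center_def by (elim exE conjE) (rule level_inj, rule level_unique)

text \<open>Serves to make the planted vector tend to 0. The block starts at twice the left end of
  the \<open>u\<close>-th interval of \<open>high\<close>, leaving a long run below it; the bound by
  \<open>3 * 10 ^ u\<close> ties each \<open>u\<close> to finitely many positions.\<close>

lemma elev_center:
  assumes "center q m" "\<bar>i\<bar> \<le> int q"
  obtains u where "2 * int q + int u \<le> int (elev (m + i))" "0 \<le> m + i" "m + i \<le> 3 * 10 ^ u"
proof -
  obtain j where "10 ^ level q j \<le> m" "m < 2 * 10 ^ level q j"
    using assms(1) by (auto simp: center_def)
  moreover define u where "u = level q j"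
  ultimately have m: "10 ^ u \<le> m" "m < 2 * 10 ^ u" by auto
  have u: "q < u" using less_level u_def by simp
  then have ten: "10 * int u \<le> 10 ^ u" by (intro ten_power_ge) simp
  have q: "int q + 1 \<le> int u" "0 \<le> int q" "- int q \<le> i" "i \<le> int q" using u assms(2) by auto
  have b: "10 ^ u + (4 * int q + 2 * int u) \<le> 2 * m + 2 * i + 2" "m + i \<le> 3 * 10 ^ u" "0 < m + i"
    using ten q m by linarith+
  have "2 * int q + int u \<le> int (elev (m + i))"
    by (rule elev_ge_decade[OF _ b(2,3)]) (use b(1) in \<open>simp add: algebra_simps\<close>)
  then show thesis
    using that[of u] b by simp
qed

text \<open>The separation estimate: \<open>2 * q\<close> absorbs the pattern of index
  \<open>q\<close> with its local weight, and the remaining \<open>p\<close> makes its interference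
  with index \<open>p\<close> at most \<open>(1 / 2) ^ p\<close>.\<close>

lemma elev_center_diff:
  assumes "center p n" "center q m" "n \<noteq> m" "\<bar>i\<bar> \<le> int q"
  shows "2 * int q + int p < int (elev (m - n + i))"
proof -
  obtain j where "10 ^ level p j \<le> n" "n < 2 * 10 ^ level p j" and n_dvd: "period p dvd n"
    using assms(1) by (auto simp: center_def)
  moreover define v where "v = level p j"
  ultimately have n: "10 ^ v \<le> n" "n < 2 * 10 ^ v" by auto
  obtain l where "10 ^ level q l \<le> m" "m < 2 * 10 ^ level q l" and m_dvd: "period q dvd m"
    using assms(2) by (auto simp: center_def)
  moreover define u where "u = level q l"
  ultimately have m: "10 ^ u \<le> m" "m < 2 * 10 ^ u" by auto
  have uv: "p < v" "q < u" using less_level u_def v_def by auto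
  consider "u = v" | "v < u" | "u < v" by linarith
  then show ?thesis
  proof cases
    \<comment> \<open>Same block: the difference is a nonzero multiple of the common period.\<close>
    case 1
    then have pq: "p = q" using level_inj u_def v_def by blast
    with n_dvd m_dvd obtain k where k: "m - n = period p * k"
      by (metis dvd_diff dvdE)
    have "k \<noteq> 0" using k assms(3) by auto
    then consider "1 \<le> k" | "k \<le> -1" by linarith
    then show ?thesis
    proof cases
      case 1
      then show ?thesis using elev_ge_multiple[of k i p] assms(4) k pq by simp
    next
      case 2
      then have "m - n + i \<le> - (200 * int p + 40) + int p"
        using period_mult_ge[of "- k" p] k assms(4) pq by simp
      then show ?thesis using elev_neg[of "m - n + i"] pq by simp
    qed
  next
    \<comment> \<open>\<open>m - n\<close> lies between \<open>4 / 5 * 10 ^ u\<close> and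
      \<open>2 * 10 ^ u\<close>, well inside the \<open>u\<close>-th interval of
      \<open>high\<close>.\<close>
    case 2
    have ten: "10 * 10 ^ v \<le> (10::int) ^ u" "50 * int u \<le> 10 ^ u"
      using 2 uv by (auto intro!: ten_power_le ten_power_ge')
    have pq: "int q + 1 \<le> int u" "int p + 1 \<le> int v" "int v + 1 \<le> int u" "0 \<le> int q" "0 \<le> int p"
      "- int q \<le> i" "i \<le> int q"
      using uv 2 assms(4) by auto
    have b: "10 ^ u + (4 * int q + 2 * int p + 2) \<le> 2 * m - 2 * n + 2 * i + 2"
      "m - n + i \<le> 3 * 10 ^ u" "0 < m - n + i"
      using ten pq n m by linarith+
    have "2 * int q + int p + 1 \<le> int (elev (m - n + i))"
      by (rule elev_ge_decade[OF _ b(2,3)]) (use b(1) in \<open>simp add: algebra_simps\<close>)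
    then show ?thesis by simp
  next
    \<comment> \<open>The difference is below \<open>- 4 / 5 * 10 ^ v\<close> up to
      \<open>q\<close>, and \<open>elev\<close> is the absolute value there.\<close>
    case 3
    have "10 * 10 ^ u \<le> (10::int) ^ v" "50 * int v \<le> 10 ^ v"
      using 3 uv by (auto intro!: ten_power_le ten_power_ge')
    moreover have "int q + 1 \<le> int u" "int p + 1 \<le> int v" "int u + 1 \<le> int v" "0 \<le> int q" "0 \<le> int p"
      "i \<le> int q"
      using uv 3 assms(4) by auto
    ultimately have "m - n + i < - (2 * int q + int p)"
      using n m by linarith
    then show ?thesis using elev_neg[of "m - n + i"] by simp
  qed
qed

section \<open>Density estimates\<close>

lemma card_multiples_ge:
  assumes "0 < b" "0 < (L::int)"
  shows "L div b \<le> int (card {n \<in> {a..<a + L}. b dvd n})"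
proof -
  \<comment> \<open>\<open>- ((- a) div b)\<close> is the ceiling of \<open>a / b\<close>, so
    \<open>?f\<close> lists multiples of \<open>b\<close> from the first one not below
    \<open>a\<close>.\<close>
  let ?f = "\<lambda>k. b * (k - ((- a) div b))"
  have "?f ` {0..<L div b} \<subseteq> {n \<in> {a..<a + L}. b dvd n}"
  proof clarify
    fix k assume k: "k \<in> {0..<L div b}"
    have 1: "a \<le> - (b * ((- a) div b))" "- (b * ((- a) div b)) < a + b"
      using mult_div_mod_eq[of b "- a"] pos_mod_bound[of b "- a"] pos_mod_sign[of b "- a"] assms
      by linarith+
    have "b * k \<le> b * (L div b - 1)" "0 \<le> b * k" using k assms by (auto intro: mult_left_mono)
    moreover have "b * (L div b) \<le> L"
      using mult_div_mod_eq[of b L] pos_mod_sign[of b L] assms by linarith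
    ultimately show "?f k \<in> {a..<a + L} \<and> b dvd ?f k"
      using 1 by (auto simp: algebra_simps)
  qed
  then have "card (?f ` {0..<L div b}) \<le> card {n \<in> {a..<a + L}. b dvd n}"
    by (intro card_mono finite_subset[OF _ finite_atLeastLessThan_int[of a "a + L"]]) auto
  moreover have "card (?f ` {0..<L div b}) = nat (L div b)"
    using assms by (subst card_image) (auto simp: inj_on_def)
  ultimately show ?thesis by linarith
qed

text \<open>When \<open>N\<close> lies between the ends of consecutive blocks of index
  \<open>p\<close>, whose ratio is \<open>10 ^ r\<close>, the earlier block is complete and
  contributes at least \<open>10 ^ u / (2 * period p)\<close> centers.\<close>

lemma center_lower_density:
  "\<exists>c>0. \<forall>\<^sub>F N in sequentially. c \<le> real (card {n \<in> {1..N}. center p (int n)}) / real N"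
proof -
  define r :: nat where "r = 2 * 2 ^ p"
  have step: "level p (Suc j) = level p j + r" for j
    by (simp add: level_def r_def algebra_simps)
  \<comment> \<open>A factor \<open>2 * period p\<close> from counting multiples and a factor
    \<open>2 * 10 ^ r\<close> from the bound on \<open>N\<close>.\<close>
  define c :: real where "c = 1 / (4 * period p * 10 ^ r)"
  have pp: "0 < real_of_int (period p)" using period_pos by simp
  have c: "c > 0" using period_pos by (simp add: c_def)
  have level_ge: "j \<le> level p j" for j
  proof -
    have "1 * j \<le> 2 ^ p * (2 * j + 1)" by (intro mult_mono) auto
    then show ?thesis by (simp add: level_def)
  qed
  \<comment> \<open>From \<open>J\<close> on a block holds at least two periods, so rounding down in
    \<open>div\<close> costs at most a factor 2.\<close>
  obtain J where J: "2 * period p \<le> 10 ^ J"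
  proof -
    obtain J :: nat where "real_of_int (2 * period p) < 10 ^ J"
      using real_arch_pow[of 10] by auto
    then have "2 * period p < 10 ^ J" by (metis of_int_less_iff of_int_numeral of_int_power)
    then show ?thesis using that[of J] by simp
  qed
  have "c \<le> real (card {n \<in> {1..N}. center p (int n)}) / real N"
    if N: "2 * 10 ^ level p J \<le> N" for N
  proof -
    have "\<exists>j. 2 * 10 ^ level p j > N"
    proof
      have "N < 10 ^ N" by (rule power_gt_expt) simp
      also have "(10::nat) ^ N \<le> 10 ^ level p N" by (intro power_increasing level_ge) simp
      finally show "2 * 10 ^ level p N > N" by simp
    qed
    then obtain k where k: "2 * 10 ^ level p k > N" "\<And>i. i < k \<Longrightarrow> \<not> 2 * 10 ^ level p i > N"
      using exists_least_iff[of "\<lambda>j. 2 * 10 ^ level p j > N"] by auto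
    have "J < k"
    proof (rule ccontr)
      assume "\<not> J < k"
      then have "level p k \<le> level p J" by (simp add: level_def)
      then have "(10::nat) ^ level p k \<le> 10 ^ level p J" by (intro power_increasing) auto
      with N k(1) show False by linarith
    qed
    then obtain j where j: "k = Suc j" "J \<le> j" by (cases k) auto
    define u where "u = level p j"
    have lo: "2 * 10 ^ u \<le> N" using k(2)[of j] j by (simp add: u_def)
    have hi: "N < 2 * 10 ^ u * 10 ^ r" using k(1) j step[of j] by (simp add: u_def power_add)
    have "10 ^ J \<le> (10::int) ^ u"
      using level_ge[of j] j by (intro power_increasing) (auto simp: u_def)
    then have big: "2 * period p \<le> 10 ^ u" using J by linarith
    have sub: "{n \<in> {10 ^ u..<10 ^ u + 10 ^ u}. period p dvd n}
        \<subseteq> int ` {n \<in> {1..N}. center p (int n)}"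
    proof
      fix x :: int assume x: "x \<in> {n \<in> {10 ^ u..<10 ^ u + 10 ^ u}. period p dvd n}"
      have "0 < (10::int) ^ u" by simp
      have "int (2 * 10 ^ u) \<le> int N" using lo by (rule of_nat_mono)
      then have "1 \<le> nat x" "nat x \<le> N" "int (nat x) = x"
        using x \<open>0 < (10::int) ^ u\<close> by auto
      moreover have "center p x" using x by (auto simp: center_def u_def)
      ultimately show "x \<in> int ` {n \<in> {1..N}. center p (int n)}" by (intro image_eqI[of _ _ "nat x"]) auto
    qed
    have "card {n \<in> {(10::int) ^ u..<10 ^ u + 10 ^ u}. period p dvd n}
        \<le> card (int ` {n \<in> {1..N}. center p (int n)})"
      by (rule card_mono[OF _ sub]) simp
    also have "\<dots> \<le> card {n \<in> {1..N}. center p (int n)}" by (rule card_image_le) simp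
    finally have "10 ^ u div period p \<le> int (card {n \<in> {1..N}. center p (int n)})"
      using card_multiples_ge[of "period p" "10 ^ u" "10 ^ u"] period_pos[of p] by simp
    then have C: "real_of_int (10 ^ u div period p) \<le> real (card {n \<in> {1..N}. center p (int n)})"
      by linarith
    have "(10::int) ^ u \<le> 2 * period p * (10 ^ u div period p)"
    proof -
      have "10 ^ u mod period p < period p" "period p * 2 \<le> 10 ^ u"
        using period_pos big by auto
      then show ?thesis using mult_div_mod_eq[of "period p" "10 ^ u"] by linarith
    qed
    then have "real_of_int (10 ^ u) \<le> real_of_int (2 * period p * (10 ^ u div period p))"
      by (simp only: of_int_le_iff)
    then have "10 ^ u \<le> 2 * real_of_int (period p) * real_of_int (10 ^ u div period p)" by simp
    also have "\<dots> \<le> 2 * real_of_int (period p) * real (card {n \<in> {1..N}. center p (int n)})"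
      using C pp by (intro mult_left_mono) auto
    finally have D: "10 ^ u \<le> 2 * real_of_int (period p) * real (card {n \<in> {1..N}. center p (int n)})" .
    have "real N < real (2 * 10 ^ u * 10 ^ r)" using hi by (simp only: of_nat_less_iff)
    then have "real N \<le> 2 * 10 ^ r * 10 ^ u" by (simp add: mult_ac)
    also have "\<dots> \<le> 2 * 10 ^ r * (2 * real_of_int (period p) * real (card {n \<in> {1..N}. center p (int n)}))"
      using D by (intro mult_left_mono) auto
    finally have "c * real N \<le> real (card {n \<in> {1..N}. center p (int n)})"
      using pp by (simp add: c_def field_simps)
    moreover have "0 < N" using lo by (cases N) auto
    ultimately show ?thesis by (simp add: field_simps)
  qed
  then show ?thesis using c unfolding eventually_sequentially by blast
qed

lemma card_near_multiples_le:
  assumes "0 \<le> X"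
  shows "real (card {n \<in> {0<..X}. \<exists>k\<ge>1. period p * k - 4 * int p \<le> n \<and> n \<le> period p * k + int p})
    \<le> real_of_int X / 20 * (1 / 2) ^ p" (is "real (card ?B) \<le> _")
proof (cases "?B = {}")
  case True
  show ?thesis unfolding True using assms by simp
next
  case False
  then obtain n k where nk: "n \<le> X" "1 \<le> k" "period p * k - 4 * int p \<le> n" by auto
  \<comment> \<open>A single point in the set already forces this, so the extra
    \<open>4 * int p\<close> in \<open>?K\<close> costs at most a factor 2.\<close>
  then have X: "4 * int p \<le> X" using period_mult_ge[of k p] by linarith
  let ?K = "(X + 4 * int p) div period p"
  have "?B \<subseteq> (\<lambda>(k, s). period p * k + s) ` ({1..?K} \<times> {- 4 * int p..int p})"
  proof
    fix n assume "n \<in> ?B"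
    then obtain k where k: "n \<le> X" "1 \<le> k" "period p * k - 4 * int p \<le> n" "n \<le> period p * k + int p"
      by auto
    then have "period p * k \<le> X + 4 * int p" by simp
    then have "(period p * k) div period p \<le> ?K" using period_pos[of p] by (intro zdiv_mono1)
    then have "k \<le> ?K" using period_pos[of p] by simp
    then show "n \<in> (\<lambda>(k, s). period p * k + s) ` ({1..?K} \<times> {- 4 * int p..int p})"
      using k by (intro image_eqI[of _ _ "(k, n - period p * k)"]) auto
  qed
  then have "card ?B \<le> card ({1..?K} \<times> {- 4 * int p..int p})"
    using surj_card_le[of "{1..?K} \<times> {- 4 * int p..int p}" ?B] by auto
  also have "\<dots> = nat ?K * nat (5 * int p + 1)" by (simp add: card_cartesian_product)
  finally have "real (card ?B) \<le> real (nat ?K * nat (5 * int p + 1))" by (simp only: of_nat_le_iff)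
  moreover have "0 \<le> ?K" using X period_pos[of p] by (simp add: pos_imp_zdiv_nonneg_iff)
  ultimately have "real (card ?B) \<le> real_of_int ?K * (5 * real p + 1)" by simp
  also have "\<dots> \<le> (real_of_int (X + 4 * int p) / real_of_int (period p)) * (5 * real p + 1)"
    by (intro mult_right_mono real_of_int_div4) auto
  also have "\<dots> = real_of_int (X + 4 * int p) / (40 * 2 ^ p)"
  proof -
    have "5 * real p + 1 \<noteq> 0" using of_nat_0_le_iff[of p, where ?'a = real] by linarith
    then show ?thesis by (simp add: period_def)
  qed
  also have "\<dots> \<le> (2 * real_of_int X) / (40 * 2 ^ p)"
    using X by (intro divide_right_mono) auto
  also have "\<dots> = real_of_int X / 20 * (1 / 2) ^ p" by (simp add: power_divide)
  finally show ?thesis .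
qed


text \<open>Below \<open>5 * 10 ^ u\<close>, the gap \<open>(3 * 10 ^ u, 5 * 10 ^ u)\<close> avoids
  the second family of \<open>high\<close>, and the first removes at most \<open>10 ^ u / 2\<close>
  of its points; at least \<open>10 ^ u\<close> remain, a fifth.\<close>

lemma elev_zero_upper_density:
  "\<exists>\<^sub>F N in sequentially. 1 / 5 * real N \<le> real (card ({n. elev (int n) = 0} \<inter> {..<N}))"
  unfolding frequently_sequentially
proof
  fix N0 :: nat
  define u where "u = Suc N0"
  define X :: int where "X = 5 * 10 ^ u"
  define near where "near p = {n \<in> {0<..X}. \<exists>k\<ge>1. period p * k - 4 * int p \<le> n \<and> n \<le> period p * k + int p}"
    for p
  define Z :: "int set" where "Z = {3 * 10 ^ u<..<5 * 10 ^ u}"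
  \<comment> \<open>For \<open>p \<ge> X\<close> even the neighbourhood of the first multiple starts
    beyond \<open>X\<close>.\<close>
  let ?U = "\<Union>p<nat X. near p"
  let ?S = "{n. elev (int n) = 0} \<inter> {..<5 * 10 ^ u}"
  have ten: "10 \<le> (10::int) ^ u" using power_increasing[of 1 u "10::int"] by (simp add: u_def)
  have sub: "Z - ?U \<subseteq> int ` ?S"
  proof
    fix n assume n: "n \<in> Z - ?U"
    then have n': "3 * 10 ^ u < n" "n < 5 * 10 ^ u" "0 < n" using ten by (auto simp: Z_def)
    have "n \<notin> high"
    proof
      assume "n \<in> high"
      then consider p k where "1 \<le> k" "period p * k - 4 * int p \<le> n" "n \<le> period p * k + int p"
        | v :: nat where "10 ^ v \<le> 2 * n" "n \<le> 3 * 10 ^ v"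
        unfolding high_def by blast
      then show False
      proof cases
        case 1
        then have "n \<in> near p" using n' by (auto simp: near_def X_def)
        moreover have "int p < X" using 1 period_mult_ge[of k p] n' by (simp add: X_def)
        ultimately show False using n by auto
      next
        case 2
        show False
        proof (cases "v \<le> u")
          case True
          then have "(10::int) ^ v \<le> 10 ^ u" by (intro power_increasing) auto
          then show False using 2 n' by linarith
        next
          case False
          then show False using ten_power_le[of u v] 2 n' by linarith
        qed
      qed
    qed
    then have "elev (int (nat n)) = 0" using elev_eq_0 n' by simp
    moreover have "nat n < 5 * 10 ^ u" using n' by (simp add: nat_less_iff)
    ultimately show "n \<in> int ` ?S" using n' by (intro image_eqI[of _ _ "nat n"]) auto
  qed
  have fin: "finite (near p)" for p
    by (rule finite_subset[of _ "{0<..X}"]) (auto simp: near_def)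
  have "real (card ?U) \<le> real (\<Sum>p<nat X. card (near p))"
    by (simp only: of_nat_le_iff) (rule card_UN_le, simp)
  also have "\<dots> \<le> (\<Sum>p<nat X. real_of_int X / 20 * (1 / 2) ^ p)"
    unfolding of_nat_sum near_def by (intro sum_mono card_near_multiples_le) (simp add: X_def)
  also have "\<dots> = real_of_int X / 20 * (\<Sum>p<nat X. (1 / 2) ^ p)" by (simp add: sum_distrib_left)
  also have "\<dots> \<le> real_of_int X / 20 * 2"
    by (intro mult_left_mono) (auto simp: sum_gp_strict X_def)
  finally have U: "real (card ?U) \<le> 10 ^ u / 2" by (simp add: X_def)
  have "card Z = nat (2 * 10 ^ u - 1)" by (simp add: Z_def)
  then have Z: "real (card Z) = 2 * 10 ^ u - 1" using ten by simp
  have "card Z - card ?U \<le> card (Z - ?U)" by (intro diff_card_le_card_Diff) (auto simp: fin)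
  also have "\<dots> \<le> card (int ` ?S)" by (rule card_mono[OF _ sub]) auto
  also have "\<dots> \<le> card ?S" by (rule card_image_le) auto
  finally have "real (card Z) \<le> real (card ?U) + real (card ?S)" by linarith
  moreover have "(10::real) \<le> 10 ^ u" using power_increasing[of 1 u "10::real"] by (simp add: u_def)
  ultimately have "(10::real) ^ u \<le> real (card ?S)" using U Z by linarith
  then have "1 / 5 * real (5 * 10 ^ u) \<le> real (card ?S)" by simp
  moreover have "N0 \<le> 5 * 10 ^ u"
  proof -
    have "u < 10 ^ u" by (rule power_gt_expt) simp
    then show ?thesis by (simp add: u_def)
  qed
  ultimately show "\<exists>N\<ge>N0. 1 / 5 * real N \<le> real (card ({n. elev (int n) = 0} \<inter> {..<N}))" by blast
qed

section \<open>The weighted shift\<close>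

definition coord :: "c0 \<Rightarrow> int \<Rightarrow> real" where
  "coord x = apply_bcontfun (c0_rep x)"

definition c0_of :: "(int \<Rightarrow> real) \<Rightarrow> c0" where
  "c0_of f = Abs_c0 (Bcontfun f)"

lemma tendsto_0_cofinite_iff:
  fixes f :: "int \<Rightarrow> real"
  shows "(f \<longlongrightarrow> 0) cofinite \<longleftrightarrow> (\<forall>e>0. finite {j. e \<le> \<bar>f j\<bar>})"
  by (simp add: tendsto_iff eventually_cofinite not_less)

lemma finite_coord_ge: "0 < e \<Longrightarrow> finite {j. e \<le> \<bar>coord x j\<bar>}"
  using c0_rep[of x] tendsto_0_cofinite_iff[of "coord x"] by (simp add: c0_set_def coord_def)

lemma coord_c0_of:
  assumes "\<And>e. 0 < e \<Longrightarrow> finite {j. e \<le> \<bar>f j\<bar>}"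
  shows "coord (c0_of f) = f"
proof -
  have fin: "finite {j. 1 \<le> \<bar>f j\<bar>}" by (rule assms) simp
  \<comment> \<open>The sum bounds \<open>f\<close> on the finite set where it reaches 1, the
    summand 1 elsewhere.\<close>
  have "\<bar>f j\<bar> \<le> 1 + (\<Sum>i\<in>{j. 1 \<le> \<bar>f j\<bar>}. \<bar>f i\<bar>)" for j
  proof (cases "1 \<le> \<bar>f j\<bar>")
    case True
    then have "\<bar>f j\<bar> \<le> (\<Sum>i\<in>{j. 1 \<le> \<bar>f j\<bar>}. \<bar>f i\<bar>)" by (intro member_le_sum fin) auto
    then show ?thesis by simp
  next
    case False
    have "0 \<le> (\<Sum>i\<in>{j. 1 \<le> \<bar>f j\<bar>}. \<bar>f i\<bar>)" by (intro sum_nonneg) simp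
    then show ?thesis using False by linarith
  qed
  then have "f \<in> bcontfun"
    by (intro bcontfun_normI[where b = "1 + (\<Sum>i\<in>{j. 1 \<le> \<bar>f j\<bar>}. \<bar>f i\<bar>)"])
      (simp_all only: real_norm_def Topological_Spaces.continuous_on_discrete)
  then have f: "apply_bcontfun (Bcontfun f) = f" by (rule Bcontfun_inverse)
  then have "Bcontfun f \<in> c0_set" using assms tendsto_0_cofinite_iff[of f] by (simp add: c0_set_def)
  then show ?thesis using f by (simp add: coord_def c0_of_def Abs_c0_inverse)
qed

lemma c0_eqI: "(\<And>j. coord x j = coord y j) \<Longrightarrow> x = y"
  unfolding coord_def by (intro c0_rep_inject[THEN iffD1] bcontfun_eqI)

lemma abs_coord_le_norm: "\<bar>coord x j\<bar> \<le> norm x"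
  unfolding coord_def norm_c0.rep_eq using norm_bounded[of "c0_rep x" j] by simp

lemma norm_c0_le: "(\<And>j. \<bar>coord x j\<bar> \<le> b) \<Longrightarrow> norm x \<le> b"
  unfolding coord_def norm_c0.rep_eq by (intro norm_bound) simp

lemma coord_add: "coord (x + y) j = coord x j + coord y j"
  by (simp add: coord_def plus_c0.rep_eq)

lemma coord_diff: "coord (x - y) j = coord x j - coord y j"
  by (simp add: coord_def minus_c0.rep_eq)

lemma coord_scaleR: "coord (r *\<^sub>R x) j = r * coord x j"
  by (simp add: coord_def scaleR_c0.rep_eq)

lemma bounded_linear_coord: "bounded_linear (\<lambda>x. coord x j)"
  by (rule bounded_linear_intro[of _ 1]) (auto simp: coord_add coord_scaleR abs_coord_le_norm)

section \<open>The shift and its iterates\<close>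

definition shift :: "c0 \<Rightarrow> c0" where
  "shift x = c0_of (\<lambda>j. 2 ^ elev (j + 1) / 2 ^ elev j * coord x (j + 1))"

lemma abs_shift_le: "\<bar>2 ^ elev (j + 1) / 2 ^ elev j * c\<bar> \<le> 2 * \<bar>c :: real\<bar>"
proof -
  have "(2::real) ^ elev (j + 1) \<le> 2 ^ (elev j + 1)"
    by (intro power_increasing elev_step) simp
  then have "(2::real) ^ elev (j + 1) / 2 ^ elev j \<le> 2" by (simp add: field_simps)
  then have "2 ^ elev (j + 1) / 2 ^ elev j * \<bar>c\<bar> \<le> 2 * \<bar>c\<bar>" by (intro mult_right_mono) auto
  then show ?thesis by (simp add: abs_mult)
qed

lemma coord_shift: "coord (shift x) j = 2 ^ elev (j + 1) / 2 ^ elev j * coord x (j + 1)"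
proof -
  have "finite {j. e \<le> \<bar>2 ^ elev (j + 1) / 2 ^ elev j * coord x (j + 1)\<bar>}" if "0 < e" for e :: real
  proof (rule finite_subset)
    show "finite ((\<lambda>j. j + 1) -` {j. e / 2 \<le> \<bar>coord x j\<bar>})"
      using that by (intro finite_vimageI finite_coord_ge) (auto simp: inj_def)
    show "{j. e \<le> \<bar>2 ^ elev (j + 1) / 2 ^ elev j * coord x (j + 1)\<bar>}
        \<subseteq> (\<lambda>j. j + 1) -` {j. e / 2 \<le> \<bar>coord x j\<bar>}"
      using order_trans[OF _ abs_shift_le] by fastforce
  qed
  then show ?thesis unfolding shift_def by (subst coord_c0_of) auto
qed

text \<open>The weight quotients telescope.\<close>

lemma coord_shift_funpow:
  "coord ((shift ^^ n) x) j = 2 ^ elev (j + int n) / 2 ^ elev j * coord x (j + int n)"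
proof (induction n arbitrary: j)
  case (Suc n)
  show ?case by (simp add: coord_shift Suc algebra_simps)
qed simp

lemma bounded_linear_shift: "bounded_linear shift"
proof (rule bounded_linear_intro[of _ 2])
  show "shift (x + y) = shift x + shift y" for x y
    by (rule c0_eqI) (simp add: coord_shift coord_add distrib_left)
  show "shift (r *\<^sub>R x) = r *\<^sub>R shift x" for r x
    by (rule c0_eqI) (simp add: coord_shift coord_scaleR)
  show "norm (shift x) \<le> norm x * 2" for x
  proof (rule norm_c0_le)
    fix j
    have "\<bar>coord (shift x) j\<bar> \<le> 2 * \<bar>coord x (j + 1)\<bar>" unfolding coord_shift by (rule abs_shift_le)
    also have "\<dots> \<le> norm x * 2" using abs_coord_le_norm[of x "j + 1"] by simp
    finally show "\<bar>coord (shift x) j\<bar> \<le> norm x * 2" .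
  qed
qed

text \<open>The second component of the decoded pair is padding: every finite rational sequence recurs for
  arbitrarily large \<open>p\<close>, and then the truncation by \<open>p\<close> is void.\<close>

definition pattern :: "nat \<Rightarrow> int \<Rightarrow> real" where
  "pattern p i = (let l = (from_nat (fst (prod_decode p)) :: rat list); k = int_encode i in
     if k < length l \<and> \<bar>i\<bar> \<le> int p \<and> \<bar>l ! k\<bar> \<le> of_nat p then of_rat (l ! k) else 0)"

lemma abs_pattern_le: "\<bar>pattern p i\<bar> \<le> real p"
proof -
  have "\<bar>of_rat r :: real\<bar> \<le> real p" if "\<bar>r\<bar> \<le> of_nat p" for r
  proof -
    have "(of_rat \<bar>r\<bar> :: real) \<le> of_rat (of_nat p)" using that by (simp only: of_rat_less_eq)
    then show ?thesis by simp
  qed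
  then show ?thesis by (simp add: pattern_def Let_def)
qed

lemma pattern_eq_0: "int p < \<bar>i\<bar> \<Longrightarrow> pattern p i = 0"
  by (simp add: pattern_def Let_def)

lemma pattern_dense:
  assumes "0 < e"
  shows "\<exists>p\<ge>P. \<forall>i. \<bar>pattern p i - coord x i\<bar> < e"
proof -
  \<comment> \<open>Codes below \<open>K\<close> cover all coordinates of size at least
    \<open>e\<close>; at the others 0 is close enough.\<close>
  have "finite (int_encode ` {i. e \<le> \<bar>coord x i\<bar>})" using assms by (intro finite_imageI finite_coord_ge)
  then obtain K where K: "\<forall>k \<in> int_encode ` {i. e \<le> \<bar>coord x i\<bar>}. k < K"
    using finite_nat_set_iff_bounded by blast
  have "\<exists>q. \<bar>of_rat q - coord x (int_decode k)\<bar> < e" for k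
  proof -
    obtain q where "coord x (int_decode k) - e < of_rat q" "of_rat q < coord x (int_decode k) + e"
      using of_rat_dense[of "coord x (int_decode k) - e" "coord x (int_decode k) + e"] assms by auto
    then show ?thesis by (intro exI[of _ q]) (simp add: abs_less_iff)
  qed
  then obtain q where q: "\<And>k. \<bar>of_rat (q k) - coord x (int_decode k)\<bar> < e" by metis
  define M where "M = (\<Sum>k<K. nat \<bar>int_decode k\<bar> + nat \<lceil>\<bar>q k\<bar>\<rceil>)"
  define l where "l = map q [0..<K]"
  define p where "p = prod_encode (to_nat l, max P M)"
  have p: "max P M \<le> p" unfolding p_def by (rule le_prod_encode_2)
  have small: "\<bar>int_decode k\<bar> \<le> int p \<and> \<bar>q k\<bar> \<le> of_nat p" if "k < K" for k
  proof -
    have "nat \<bar>int_decode k\<bar> + nat \<lceil>\<bar>q k\<bar>\<rceil> \<le> M"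
      unfolding M_def by (rule member_le_sum) (use that in auto)
    then have M: "nat \<bar>int_decode k\<bar> \<le> p" "nat \<lceil>\<bar>q k\<bar>\<rceil> \<le> p" using p by linarith+
    have "\<bar>q k\<bar> \<le> of_nat (nat \<lceil>\<bar>q k\<bar>\<rceil>)" by (rule of_nat_ceiling)
    also have "\<dots> \<le> of_nat p" using M by (simp only: of_nat_le_iff)
    finally show ?thesis using M by auto
  qed
  have "\<bar>pattern p i - coord x i\<bar> < e" for i
  proof (cases "int_encode i < K")
    case True
    then have "pattern p i = of_rat (q (int_encode i))"
      using small[OF True] by (simp add: pattern_def p_def l_def Let_def)
    then show ?thesis using q[of "int_encode i"] by simp
  next
    case False
    then have "pattern p i = 0" by (simp add: pattern_def p_def l_def Let_def)
    moreover have "\<bar>coord x i\<bar> < e" using K False by force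
    ultimately show ?thesis by simp
  qed
  then show ?thesis using p by auto
qed

section \<open>The frequently hypercyclic vector\<close>

definition window :: "int \<Rightarrow> nat \<Rightarrow> int \<Rightarrow> bool" where
  "window k q m \<longleftrightarrow> center q m \<and> \<bar>k - m\<bar> \<le> int q"

text \<open>If windows around distinct \<open>m\<close> and \<open>n\<close> met at
  \<open>k\<close>, then \<open>elev (k - n)\<close> would exceed \<open>2 * q + p\<close> by
  separation, yet it is at most the distance from \<open>k\<close> to \<open>n\<close>, hence at
  most \<open>p\<close>.\<close>

lemma window_unique:
  assumes "window k q m" "window k p n"
  shows "m = n \<and> q = p"
proof -
  have "m = n"
  proof (rule ccontr)
    assume "m \<noteq> n"
    then have "2 * int q + int p < int (elev (m - n + (k - m)))"
      using assms by (intro elev_center_diff) (auto simp: window_def)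
    also have "\<dots> \<le> \<bar>k - n\<bar>" using elev_le_abs[of "k - n"] by simp
    also have "\<dots> \<le> int p" using assms by (simp add: window_def)
    finally show False by simp
  qed
  then show ?thesis using assms center_unique by (auto simp: window_def)
qed

text \<open>The scaling inverts the factor in \<open>coord_shift_funpow\<close>, so \<open>m\<close>
  shifts reproduce the pattern exactly in its window. Disjointness of the windows makes
  \<open>THE\<close> well defined.\<close>

definition fhc_coord :: "int \<Rightarrow> real" where
  "fhc_coord k = (if \<exists>q m. window k q m
     then THE r. \<exists>q m. window k q m \<and> r = 2 ^ elev (k - m) / 2 ^ elev k * pattern q (k - m)
     else 0)"

lemma fhc_coord_window:
  assumes "window k q m"
  shows "fhc_coord k = 2 ^ elev (k - m) / 2 ^ elev k * pattern q (k - m)"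
proof -
  have "(THE r. \<exists>q m. window k q m \<and> r = 2 ^ elev (k - m) / 2 ^ elev k * pattern q (k - m))
      = 2 ^ elev (k - m) / 2 ^ elev k * pattern q (k - m)"
    using assms window_unique[OF assms] by (intro the_equality) blast+
  then show ?thesis using assms by (auto simp: fhc_coord_def)
qed

lemma pattern_weight_le:
  assumes "window k q m"
  shows "2 ^ elev (k - m) * \<bar>pattern q (k - m)\<bar> \<le> 2 ^ (2 * q)"
proof -
  have "elev (k - m) \<le> q" using elev_le_abs[of "k - m"] assms by (simp add: window_def)
  then have "(2::real) ^ elev (k - m) \<le> 2 ^ q" by (intro power_increasing) auto
  moreover have "\<bar>pattern q (k - m)\<bar> \<le> 2 ^ q"
    using abs_pattern_le[of q "k - m"] of_nat_less_two_power[of q, where ?'a = real] by linarith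
  ultimately have "2 ^ elev (k - m) * \<bar>pattern q (k - m)\<bar> \<le> 2 ^ q * 2 ^ q" by (intro mult_mono) auto
  then show ?thesis by (simp add: power_mult power2_eq_square mult.commute flip: power_add)
qed

lemma weight_quotient_le: "a + b \<le> c \<Longrightarrow> x \<le> 2 ^ a \<Longrightarrow> x / 2 ^ c \<le> (1 / 2 :: real) ^ b"
proof -
  assume "a + b \<le> c" "x \<le> 2 ^ a"
  have "x * 2 ^ b \<le> 2 ^ a * 2 ^ b" using \<open>x \<le> 2 ^ a\<close> by (intro mult_right_mono) auto
  also have "\<dots> \<le> 2 ^ c" unfolding power_add[symmetric]
    using \<open>a + b \<le> c\<close> by (intro power_increasing) auto
  finally show ?thesis by (simp add: field_simps power_divide)
qed

lemma finite_fhc_coord_ge: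
  assumes "0 < e"
  shows "finite {k. e \<le> \<bar>fhc_coord k\<bar>}"
proof -
  obtain U where U: "(1 / 2 :: real) ^ U < e" using real_arch_pow_inv[OF assms, of "1 / 2"] by auto
  \<comment> \<open>A window in block \<open>u\<close> carries entries of size at most
    \<open>(1 / 2) ^ u\<close>, so entries of size \<open>e\<close> require
    \<open>u < U\<close>.\<close>
  have "{k. e \<le> \<bar>fhc_coord k\<bar>} \<subseteq> {0..3 * 10 ^ U}"
  proof
    fix k assume "k \<in> {k. e \<le> \<bar>fhc_coord k\<bar>}"
    then have k: "e \<le> \<bar>fhc_coord k\<bar>" by simp
    then have "fhc_coord k \<noteq> 0" using assms by auto
    then obtain q m where w: "window k q m" by (auto simp: fhc_coord_def split: if_splits)
    then have "center q m" "\<bar>k - m\<bar> \<le> int q" by (auto simp: window_def)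
    then obtain u where u: "2 * int q + int u \<le> int (elev (m + (k - m)))" "0 \<le> m + (k - m)"
      "m + (k - m) \<le> 3 * 10 ^ u"
      by (rule elev_center)
    have "\<bar>fhc_coord k\<bar> = 2 ^ elev (k - m) * \<bar>pattern q (k - m)\<bar> / 2 ^ elev k"
      by (simp add: fhc_coord_window[OF w] abs_mult)
    also have "\<dots> \<le> (1 / 2) ^ u"
      using u(1) by (intro weight_quotient_le[OF _ pattern_weight_le[OF w]]) simp
    finally have "(1 / 2 :: real) ^ U < (1 / 2) ^ u" using k U by linarith
    then have "u < U" by (simp add: power_strict_decreasing_iff)
    then have "(10::int) ^ u \<le> 10 ^ U" by (intro power_increasing) auto
    then have "k \<le> 3 * 10 ^ U" using u(3) by linarith
    then show "k \<in> {0..3 * 10 ^ U}" using u(2) by simp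
  qed
  then show ?thesis by (rule finite_subset) simp
qed

definition fhc_vector :: c0 where
  "fhc_vector = c0_of fhc_coord"

lemma coord_fhc_vector: "coord fhc_vector = fhc_coord"
  unfolding fhc_vector_def by (rule coord_c0_of) (rule finite_fhc_coord_ge)

text \<open>In the window of \<open>n\<close> the pattern is recovered exactly. Outside it
  \<open>pattern p\<close> vanishes, and anything planted at another center is damped by the
  separation estimate.\<close>

lemma shift_fhc_vector_approx:
  assumes "center p (int n)"
  shows "\<bar>coord ((shift ^^ n) fhc_vector) j - pattern p j\<bar> \<le> (1 / 2) ^ p"
proof -
  let ?k = "j + int n"
  have eq: "coord ((shift ^^ n) fhc_vector) j = 2 ^ elev ?k / 2 ^ elev j * fhc_coord ?k"
    by (simp add: coord_shift_funpow coord_fhc_vector)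
  show ?thesis
  proof (cases "\<bar>j\<bar> \<le> int p")
    case True
    then have "window ?k p (int n)" using assms by (simp add: window_def)
    then show ?thesis unfolding eq by (subst fhc_coord_window) auto
  next
    case False
    then have 0: "pattern p j = 0" by (intro pattern_eq_0) simp
    show ?thesis
    proof (cases "\<exists>q m. window ?k q m")
      case True
      then obtain q m where w: "window ?k q m" by auto
      have "int n \<noteq> m"
      proof
        assume "int n = m"
        then have "q = p" using w assms center_unique by (auto simp: window_def)
        then show False using w \<open>int n = m\<close> False by (auto simp: window_def)
      qed
      \<comment> \<open>The argument of \<open>elev\<close> is just \<open>j\<close>: the weight in
        the denominator after \<open>n\<close> shifts.\<close>
      then have "2 * int q + int p < int (elev (m - int n + (?k - m)))"
        using w assms by (intro elev_center_diff) (auto simp: window_def)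
      then have el: "2 * q + p \<le> elev j" by simp
      have "\<bar>coord ((shift ^^ n) fhc_vector) j\<bar> = 2 ^ elev (?k - m) * \<bar>pattern q (?k - m)\<bar> / 2 ^ elev j"
        unfolding eq fhc_coord_window[OF w] by (simp add: abs_mult)
      also have "\<dots> \<le> (1 / 2) ^ p" by (rule weight_quotient_le[OF el pattern_weight_le[OF w]])
      finally show ?thesis using 0 by simp
    next
      case False
      then have "fhc_coord ?k = 0" by (simp add: fhc_coord_def)
      then show ?thesis using 0 eq by simp
    qed
  qed
qed

proposition freq_hypercyclic_shift: "freq_hypercyclic shift"
  unfolding freq_hypercyclic_def
proof (intro exI[of _ fhc_vector] allI impI)
  fix V :: "c0 set" assume "open V \<and> V \<noteq> {}"
  then obtain y where "open V" "y \<in> V" by auto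
  then obtain e where e: "0 < e" "ball y e \<subseteq> V" by (rule openE)
  obtain P where P: "(1 / 2 :: real) ^ P < e / 3" using real_arch_pow_inv[of "e / 3" "1 / 2"] e by auto
  obtain p where p: "P \<le> p" "\<And>i. \<bar>pattern p i - coord y i\<bar> < e / 3"
    using pattern_dense[of "e / 3" P y] e by auto
  have "(1 / 2 :: real) ^ p \<le> (1 / 2) ^ P" using p by (intro power_decreasing) auto
  then have p': "(1 / 2 :: real) ^ p < e / 3" using P by linarith
  have in_V: "(shift ^^ n) fhc_vector \<in> V" if "center p (int n)" for n
  proof -
    \<comment> \<open>A third of \<open>e\<close> each for the pattern and for its recovery; the
      last third keeps the distance strict after the supremum.\<close>
    have "norm (y - (shift ^^ n) fhc_vector) \<le> 2 * e / 3"
    proof (rule norm_c0_le)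
      fix j
      have "\<bar>coord ((shift ^^ n) fhc_vector) j - pattern p j\<bar> \<le> e / 3"
        by (rule order_trans[OF shift_fhc_vector_approx[OF that] less_imp_le[OF p']])
      then show "\<bar>coord (y - (shift ^^ n) fhc_vector) j\<bar> \<le> 2 * e / 3"
        using p(2)[of j] unfolding coord_diff abs_le_iff abs_less_iff by linarith
    qed
    then have "dist y ((shift ^^ n) fhc_vector) < e" using e(1) by (simp add: dist_norm)
    then show ?thesis using e(2) by auto
  qed
  obtain c where c: "c > 0"
    "\<forall>\<^sub>F N in sequentially. c \<le> real (card {n \<in> {1..N}. center p (int n)}) / real N"
    using center_lower_density[of p] by (elim exE conjE)
  have "\<forall>\<^sub>F N in sequentially.
      ereal c \<le> ereal (real (card {n \<in> {1..N}. (shift ^^ n) fhc_vector \<in> V}) / real N)"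
    using c(2)
  proof eventually_elim
    case (elim N)
    have "{n \<in> {1..N}. center p (int n)} \<subseteq> {n \<in> {1..N}. (shift ^^ n) fhc_vector \<in> V}"
      using in_V by blast
    then have "card {n \<in> {1..N}. center p (int n)} \<le> card {n \<in> {1..N}. (shift ^^ n) fhc_vector \<in> V}"
      by (rule card_mono[rotated]) simp
    then have "real (card {n \<in> {1..N}. center p (int n)}) / real N
        \<le> real (card {n \<in> {1..N}. (shift ^^ n) fhc_vector \<in> V}) / real N"
      by (intro divide_right_mono) auto
    then have "c \<le> real (card {n \<in> {1..N}. (shift ^^ n) fhc_vector \<in> V}) / real N"
      by (rule order_trans[OF elim])
    then show ?case by (simp only: ereal_less_eq)
  qed
  then have "ereal c \<le> liminf (\<lambda>N. ereal (real (card {n \<in> {1..N}. (shift ^^ n) fhc_vector \<in> V}) / real N))"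
    by (rule Liminf_bounded)
  moreover have "0 < ereal c" using c(1) by simp
  ultimately show "0 < liminf (\<lambda>N. ereal (real (card {n \<in> {1..N}. (shift ^^ n) fhc_vector \<in> V}) / real N))"
    by (rule less_le_trans[rotated])
qed

section \<open>Absence of ergodic measures with full support\<close>

proposition shift_no_ergodic_full_support:
  assumes "borel_prob_measure m" "invariant_measure shift m" "ergodic_measure shift m"
  shows "\<not> full_support m"
proof
  assume full: "full_support m"
  have sets: "sets m = sets borel" and "prob_space m"
    using assms(1) by (auto simp: borel_prob_measure_def)
  interpret prob_space m by fact
  have space: "space m = UNIV" using sets_eq_imp_space_eq[OF sets] by simp
  have "continuous_on UNIV shift"
    by (simp add: bounded_linear_shift linear_continuous_on)
  then have "shift \<in> borel_measurable borel" by (rule borel_measurable_continuous_onI)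
  then have meas: "shift \<in> measurable m m" using sets by (simp cong: measurable_cong_sets)
  interpret measure_preserving m shift
  proof
    show "distr m m shift = m"
    proof (rule measure_eqI)
      fix B assume "B \<in> sets (distr m m shift)"
      then have "B \<in> sets m" by simp
      then show "emeasure (distr m m shift) B = emeasure m B"
        using assms(2) sets meas by (simp add: emeasure_distr space invariant_measure_def)
    qed simp
  qed (rule meas)
  have "(\<lambda>n. measure m (cball 0 (real n))) \<longlonglongrightarrow> measure m (\<Union>n. cball 0 (real n))"
    by (rule finite_Lim_measure_incseq) (auto simp: sets incseq_def)
  moreover have "(\<Union>n. cball (0::c0) (real n)) = space m"
    using real_arch_simple by (auto simp: space)
  ultimately have "(\<lambda>n. measure m (cball 0 (real n))) \<longlonglongrightarrow> 1" by (simp add: prob_space)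
  then have "\<forall>\<^sub>F n in sequentially. 1 - 1 / 5 < measure m (cball 0 (real n))"
    by (rule order_tendstoD) simp
  then obtain n where n: "1 - 1 / 5 < measure m (cball 0 (real n))"
    by (auto simp: eventually_sequentially)
  define A where "A = {x. real n < \<bar>coord x 0\<bar>}"
  have "continuous_on UNIV (\<lambda>x. coord x 0)"
    by (simp add: bounded_linear_coord linear_continuous_on)
  then have A: "open A" unfolding A_def by (intro open_Collect_less continuous_intros)
  \<comment> \<open>A multiple of a unit vector shows that \<open>A\<close> is nonempty, so full
    support gives it positive measure.\<close>
  have "finite {j::int. e \<le> \<bar>if j = 0 then real n + 1 else 0\<bar>}" if "0 < e" for e
    by (rule finite_subset[of _ "{0}"]) (use that in \<open>auto split: if_splits\<close>)
  then have "coord (c0_of (\<lambda>j. if j = 0 then real n + 1 else 0)) = (\<lambda>j. if j = 0 then real n + 1 else 0)"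
    by (intro coord_c0_of)
  then have "c0_of (\<lambda>j. if j = 0 then real n + 1 else 0) \<in> A" by (simp add: A_def)
  then have "emeasure m A > 0" using full A by (auto simp: full_support_def)
  then have pos: "measure m A > 0" by (simp add: emeasure_eq_measure)
  have "measure m (cball 0 (real n)) \<le> 1 - 1 / 5"
  proof (rule prob_le_if_misses_upper_density[where A = A and D = "{n. elev (int n) = 0}"])
    show "emeasure m B = 0 \<or> emeasure m B = 1" if "B \<in> sets m" "shift -` B \<inter> space m = B" for B
      using that assms(3) by (simp add: ergodic_measure_def sets space)
    show "(shift ^^ d) x \<notin> A" if "x \<in> cball 0 (real n)" "d \<in> {n. elev (int n) = 0}" for x d
      using that abs_coord_le_norm[of x "int d"]
      by (simp add: A_def coord_shift_funpow elev_neg)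
  qed (use A pos elev_zero_upper_density in \<open>auto simp: sets\<close>)
  then show False using n by simp
qed

theorem theorem1p3:
  shows "\<exists>T :: c0 \<Rightarrow> c0. bounded_linear T \<and> freq_hypercyclic T \<and>
           \<not> (\<exists>m. borel_prob_measure m \<and> invariant_measure T m \<and>
                  ergodic_measure T m \<and> full_support m)"
  using bounded_linear_shift freq_hypercyclic_shift shift_no_ergodic_full_support by blast

end
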